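(* Let $A$ be a finite set of colours and let $\Bbbk T_A$ be the Hopf algebra of rooted ordered $A$-coloured trees, with the concatenation multiplication and the pruning coproduct $\Delta$. Then the planted tall trees generate a Hopf subalgebra of $\Bbbk T_A$.
   Context: $\Bbbk$ is a field of characteristic zero. A rooted ordered tree is a finite rooted tree in which the children of every vertex are totally ordered. A rooted ordered coloured (ROC) tree over a finite set $A$ is a rooted ordered tree together with a function from its set of edges to $A$. $T_A$ is the set of ROC trees and $\Bbbk T_A$ is the $\Bbbk$-vector space with basis $T_A$, graded by the number of edges. The trivial tree $\bullet$ has only a root. A planted tree is a non-trivial tree whose root has exactly one child. Product (concatenation): $t\cdot s$ is obtained by identifying the roots of $t$ and $s$, placing the branches of $t$ to the left of those of $s$; the unit is $\bullet$. Pruning coproduct: an admissible subtree $t_s$ of $t$ is a rooted subtree (connected subgraph) containing the root of $t$ (the trivial tree and $t$ itself are allowed), with order and colours inherited. Removing $t_s$ from $t$ prunes a sequence $(t_1,\dots,t_m)$ of planted trees (the branches of $t$ attached to vertices of $t_s$ by edges not in $t_s$, each with its lowest edge), ordered by the order inherited from $t$ (left-to-right depth-first order); the complementary tree is $t_c=t_1\cdot\ldots\cdot t_m$. Then $\Delta(t)=\sum_{t_s} t_c\otimes t_s$, summed over all admissible subtrees $t_s$ of $t$. The counit is $\epsilon(\bullet)=1$ and $\epsilon(t)=0$ for $t\ne\bullet$. With these operations $\Bbbk T_A$ is a graded connected Hopf algebra (a known result of Foissy). For $a\in A$, $B_a^+(t)$ denotes the planted tree obtained by attaching the root of $t$ to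 a new root by an additional edge coloured $a$. A planted tall tree (ladder) is a tree of the form $(B_{a_k}^+\circ\dots\circ B_{a_1}^+)(\bullet)$ with $k\ge 1$ and $a_1,\dots,a_k\in A$. *)

theory Defs
  imports Complex_Main "HOL-Library.Poly_Mapping"
begin

section \<open>Rooted ordered coloured trees\<close>

text \<open>A tree is the list (in left-to-right order) of the branches at its root; a branch consists of
  the colour of its lowest edge and the tree above that edge. The trees over a set of colours \<open>A\<close>
  are those with \<open>colours t \<subseteq> A\<close>.\<close>

datatype (colours: 'a) roc_tree = Node "('a \<times> 'a roc_tree) list"

definition roc_trees :: "'a set \<Rightarrow> 'a roc_tree set" where
  "roc_trees A = {t. colours t \<subseteq> A}"

text \<open>The monoid of trees under concatenation, written additively, so that the convolution product
  on finitely supported functions from the library is the concatenation product on the vector space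
  of trees. In particular \<open>0\<close> is the trivial tree, and \<open>1\<close> in the algebra is the trivial tree as a
  basis vector.\<close>

instantiation roc_tree :: (type) monoid_add
begin

definition zero_roc_tree :: "'a roc_tree" where
  "0 = Node []"

fun plus_roc_tree :: "'a roc_tree \<Rightarrow> 'a roc_tree \<Rightarrow> 'a roc_tree" where
  "Node bs + Node cs = Node (bs @ cs)"

instance
proof
  fix t s u :: "'a roc_tree"
  show "t + s + u = t + (s + u)"
    by (cases t; cases s; cases u) simp
  show "0 + t = t" "t + 0 = t"
    by (cases t; simp add: zero_roc_tree_def)+
qed

end

definition B_plus :: "'a \<Rightarrow> 'a roc_tree \<Rightarrow> 'a roc_tree" where
  "B_plus a t = Node [(a, t)]"

text \<open>\<open>fold B_plus [a\<^sub>1, \<dots>, a\<^sub>k] 0\<close> is the composite of \<open>B_plus a\<^sub>k, \<dots>, B_plus a\<^sub>1\<close> applied to the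
  trivial tree, with \<open>B_plus a\<^sub>1\<close> applied first.\<close>

definition planted_tall_trees :: "'a set \<Rightarrow> 'a roc_tree set" where
  "planted_tall_trees A = {fold B_plus as 0 | as. as \<noteq> [] \<and> set as \<subseteq> A}"

section \<open>Admissible subtrees\<close>

text \<open>A vertex is addressed by the path leading to it from the root, as the list of the positions
  of the successive children; the root is \<open>[]\<close>.\<close>

lemma size_nth_branch [termination_simp]:
  assumes "i < length bs"
  shows "size (snd (bs ! i)) < size (Node bs)"
proof -
  have "bs ! i \<in> set bs"
    using assms by simp
  then have "size_prod (\<lambda>_. 0) size (bs ! i) \<le> size_list (size_prod (\<lambda>_. 0) size) bs"
    by (simp add: size_list_estimation')
  then show ?thesis
    by (cases "bs ! i") simp
qed

function vertices :: "'a roc_tree \<Rightarrow> nat list set" where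
  "vertices (Node bs) = insert [] (\<Union>i\<in>{..<length bs}. (#) i ` vertices (snd (bs ! i)))"
  by pat_completeness auto
termination
  by (relation "measure size") (auto simp del: roc_tree.size intro: size_nth_branch)

text \<open>A connected subgraph containing the root is determined by its vertex set, and the vertex sets
  that arise are exactly those containing the root and closed under passing to the parent.\<close>

definition admissible :: "'a roc_tree \<Rightarrow> nat list set set" where
  "admissible t = {S. S \<subseteq> vertices t \<and> [] \<in> S \<and> (\<forall>p i. p @ [i] \<in> S \<longrightarrow> p \<in> S)}"

text \<open>The subtree \<open>t\<^sub>s\<close> with vertex set \<open>S\<close>. Here \<open>{p. i # p \<in> S}\<close> is the part of \<open>S\<close> lying in the
  \<open>i\<close>-th child, readdressed relative to that child.\<close>

function subtree :: "nat list set \<Rightarrow> 'a roc_tree \<Rightarrow> 'a roc_tree" where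
  "subtree S (Node bs) =
     Node (map (\<lambda>i. (fst (bs ! i), subtree {p. i # p \<in> S} (snd (bs ! i))))
               (filter (\<lambda>i. [i] \<in> S) [0..<length bs]))"
  by pat_completeness auto
termination
  by (relation "measure (size \<circ> snd)") (auto simp del: roc_tree.size intro: size_nth_branch)

text \<open>The sequence of planted trees pruned from \<open>t\<close>, in left-to-right depth-first order.\<close>

function pruned :: "nat list set \<Rightarrow> 'a roc_tree \<Rightarrow> 'a roc_tree list" where
  "pruned S (Node bs) =
     concat (map (\<lambda>i. if [i] \<in> S then pruned {p. i # p \<in> S} (snd (bs ! i))
                      else [B_plus (fst (bs ! i)) (snd (bs ! i))])
                 [0..<length bs])"
  by pat_completeness auto
termination
  by (relation "measure (size \<circ> snd)") (auto simp del: roc_tree.size intro: size_nth_branch)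

definition complementary_tree :: "nat list set \<Rightarrow> 'a roc_tree \<Rightarrow> 'a roc_tree" where
  "complementary_tree S t = sum_list (pruned S t)"

section \<open>Free vector spaces and tensor products\<close>

text \<open>The vector space with basis \<open>'b\<close> is the type of finitely supported functions on \<open>'b\<close>, with
  \<open>Poly_Mapping.single b 1\<close> as the basis vector of \<open>b\<close>. The tensor square of the space with basis
  \<open>'b\<close> is the space with basis \<open>'b \<times> 'b\<close>.\<close>

definition smul :: "'k::field \<Rightarrow> ('b \<Rightarrow>\<^sub>0 'k) \<Rightarrow> ('b \<Rightarrow>\<^sub>0 'k)" where
  "smul c x = Poly_Mapping.map ((*) c) x"

lemma lookup_smul [simp]: "Poly_Mapping.lookup (smul c x) b = c * Poly_Mapping.lookup x b"
  by (simp add: smul_def map.rep_eq when_def)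

global_interpretation free: vector_space "smul :: 'k::field \<Rightarrow> ('b \<Rightarrow>\<^sub>0 'k) \<Rightarrow> ('b \<Rightarrow>\<^sub>0 'k)"
  by unfold_locales
    (auto intro!: poly_mapping_eqI simp: lookup_add algebra_simps)

definition tensor :: "('b \<Rightarrow>\<^sub>0 'k::field) \<Rightarrow> ('c \<Rightarrow>\<^sub>0 'k) \<Rightarrow> ('b \<times> 'c \<Rightarrow>\<^sub>0 'k)" where
  "tensor x y = (\<Sum>b\<in>Poly_Mapping.keys x. \<Sum>c\<in>Poly_Mapping.keys y.
     Poly_Mapping.single (b, c) (Poly_Mapping.lookup x b * Poly_Mapping.lookup y c))"

text \<open>For subspaces \<open>U\<close> and \<open>V\<close> this is the image of their tensor product, which embeds since we
  are over a field.\<close>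

definition tensor_space ::
    "('b \<Rightarrow>\<^sub>0 'k::field) set \<Rightarrow> ('c \<Rightarrow>\<^sub>0 'k) set \<Rightarrow> ('b \<times> 'c \<Rightarrow>\<^sub>0 'k) set" where
  "tensor_space U V = free.span {tensor u v | u v. u \<in> U \<and> v \<in> V}"

section \<open>The Hopf algebra of trees\<close>

definition tree_space :: "'a set \<Rightarrow> ('a roc_tree \<Rightarrow>\<^sub>0 'k::field) set" where
  "tree_space A = {x. Poly_Mapping.keys x \<subseteq> roc_trees A}"

definition coproduct_tree :: "'a roc_tree \<Rightarrow> ('a roc_tree \<times> 'a roc_tree \<Rightarrow>\<^sub>0 'k::field)" where
  "coproduct_tree t =
     (\<Sum>S\<in>admissible t. Poly_Mapping.single (complementary_tree S t, subtree S t) 1)"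

definition coproduct ::
    "('a roc_tree \<Rightarrow>\<^sub>0 'k::field) \<Rightarrow> ('a roc_tree \<times> 'a roc_tree \<Rightarrow>\<^sub>0 'k)" where
  "coproduct x =
     (\<Sum>t\<in>Poly_Mapping.keys x. smul (Poly_Mapping.lookup x t) (coproduct_tree t))"

definition counit :: "('a roc_tree \<Rightarrow>\<^sub>0 'k::field) \<Rightarrow> 'k" where
  "counit x =
     (\<Sum>t\<in>Poly_Mapping.keys x. Poly_Mapping.lookup x t * (if t = 0 then 1 else 0))"

text \<open>The convolution of two linear maps: coproduct, followed by \<open>f\<close> and \<open>g\<close> on the two tensor
  factors, followed by multiplication.\<close>

definition convolution ::
    "(('a roc_tree \<Rightarrow>\<^sub>0 'k::field) \<Rightarrow> ('a roc_tree \<Rightarrow>\<^sub>0 'k)) \<Rightarrow>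
     (('a roc_tree \<Rightarrow>\<^sub>0 'k) \<Rightarrow> ('a roc_tree \<Rightarrow>\<^sub>0 'k)) \<Rightarrow>
     ('a roc_tree \<Rightarrow>\<^sub>0 'k) \<Rightarrow> ('a roc_tree \<Rightarrow>\<^sub>0 'k)" where
  "convolution f g x =
     (\<Sum>(t, s)\<in>Poly_Mapping.keys (coproduct x).
        smul (Poly_Mapping.lookup (coproduct x) (t, s))
             (f (Poly_Mapping.single t 1) * g (Poly_Mapping.single s 1)))"

text \<open>\<open>S\<close> is an antipode on the tree space over \<open>A\<close>: a linear endomorphism that is a two-sided
  convolution inverse of the identity. The values of \<open>S\<close> outside the tree space are irrelevant.\<close>

definition is_antipode ::
    "'a set \<Rightarrow> (('a roc_tree \<Rightarrow>\<^sub>0 'k::field) \<Rightarrow> ('a roc_tree \<Rightarrow>\<^sub>0 'k)) \<Rightarrow> bool" where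
  "is_antipode A S \<longleftrightarrow>
     (\<forall>x\<in>tree_space A. S x \<in> tree_space A) \<and>
     (\<forall>x\<in>tree_space A. \<forall>y\<in>tree_space A. S (x + y) = S x + S y) \<and>
     (\<forall>c. \<forall>x\<in>tree_space A. S (smul c x) = smul c (S x)) \<and>
     (\<forall>x\<in>tree_space A. convolution S id x = smul (counit x) 1) \<and>
     (\<forall>x\<in>tree_space A. convolution id S x = smul (counit x) 1)"

definition is_subalgebra :: "('a roc_tree \<Rightarrow>\<^sub>0 'k::field) set \<Rightarrow> bool" where
  "is_subalgebra H \<longleftrightarrow> free.subspace H \<and> 1 \<in> H \<and> (\<forall>x\<in>H. \<forall>y\<in>H. x * y \<in> H)"

definition subalgebra_generated ::
    "('a roc_tree \<Rightarrow>\<^sub>0 'k::field) set \<Rightarrow> ('a roc_tree \<Rightarrow>\<^sub>0 'k) set" where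
  "subalgebra_generated X = is_subalgebra hull X"

text \<open>An antipode is unique when it exists, so the existential quantifier below refers to the
  antipode of the Hopf algebra of trees over \<open>A\<close>.\<close>

definition is_Hopf_subalgebra :: "'a set \<Rightarrow> ('a roc_tree \<Rightarrow>\<^sub>0 'k::field) set \<Rightarrow> bool" where
  "is_Hopf_subalgebra A H \<longleftrightarrow>
     H \<subseteq> tree_space A \<and>
     is_subalgebra H \<and>
     (\<forall>x\<in>H. coproduct x \<in> tensor_space H H) \<and>
     (\<exists>S. is_antipode A S \<and> (\<forall>x\<in>H. S x \<in> H))"

end

theory Submission
  imports Defs
begin

text \<open>An admissible subtree of \<open>B_plus a t\<close> is either the root alone or \<open>B_plus a\<close> of one of \<open>t\<close>, and
  the admissible subtrees of \<open>t + s\<close> are the pairs of admissible subtrees of \<open>t\<close> and \<open>s\<close>. Hence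
  \<open>\<Delta>\<close> is multiplicative and satisfies \<open>\<Delta>(B_plus a t) = B_plus a t \<otimes> 1 + (id \<otimes> B_plus a) \<Delta>(t)\<close>, from
  which coassociativity follows by induction on the tree. The antipode is the antimultiplicative map
  whose values on planted trees are forced by this formula for it to be a left convolution inverse of
  the identity; by coassociativity it is also a right inverse.

  The algebra generated by the planted tall trees is spanned by the forests of ladders. The
  subtrees \<open>t\<^sub>s\<close> and complementary trees \<open>t\<^sub>c\<close> of such a forest are again forests of ladders, and the
  span of any set of trees with this closure property that is closed under products and
  factors is stable under the coproduct and the antipode.\<close>

section \<open>Decomposition of admissible subtrees\<close>

lemma parent_closed_prefix:
  assumes "\<And>p i. p @ [i] \<in> S \<Longrightarrow> p \<in> S" "p @ q \<in> S"
  shows "p \<in> S"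
  using assms(2)
proof (induction q rule: rev_induct)
  case (snoc i q)
  then show ?case using assms(1)[of "p @ q" i] by simp
qed simp

text \<open>Recursive form of admissibility: the branch at position \<open>i\<close> is either cut
  off, which is the empty case, or entered in an admissible subtree of its own. Parent closure puts
  \<open>[i]\<close> in \<open>S\<close> as soon as any address starting with \<open>i\<close> is
  there.\<close>

lemma admissible_Node:
  "S \<in> admissible (Node bs) \<longleftrightarrow>
    [] \<in> S \<and> (\<forall>i. {p. i # p \<in> S} = {} \<or>
      i < length bs \<and> {p. i # p \<in> S} \<in> admissible (snd (bs ! i)))"
  (is "?L \<longleftrightarrow> [] \<in> S \<and> (\<forall>i. ?R i)")
proof (intro iffI conjI allI)
  assume L: ?L
  then show "[] \<in> S" by (simp add: admissible_def)
  from L have cl: "\<And>p i. p @ [i] \<in> S \<Longrightarrow> p \<in> S"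
    and sub: "S \<subseteq> vertices (Node bs)"
    by (auto simp: admissible_def)
  show "?R i" for i
  proof (cases "{p. i # p \<in> S} = {}")
    case False
    then obtain p where p: "i # p \<in> S" by auto
    have "[i] \<in> S" using parent_closed_prefix[where S = S and p = "[i]" and q = p, OF cl] p by simp
    moreover have "i < length bs" using p sub by auto
    moreover have "{p. i # p \<in> S} \<subseteq> vertices (snd (bs ! i))" using sub by auto
    moreover have "q \<in> {p. i # p \<in> S}" if "q @ [j] \<in> {p. i # p \<in> S}" for q j
      using that cl[of "i # q" j] by simp
    ultimately show ?thesis by (auto simp: admissible_def)
  qed blast
next
  assume R: "[] \<in> S \<and> (\<forall>i. ?R i)"
  then have R': "i < length bs" "{p. i # p \<in> S} \<in> admissible (snd (bs ! i))"
    if "i # p \<in> S" for i p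
    using that by blast+
  have "p \<in> vertices (Node bs)" if "p \<in> S" for p
    using that R'[of "hd p" "tl p"] by (cases p) (auto simp: admissible_def)
  moreover have "p \<in> S" if "p @ [i] \<in> S" for p i
  proof (cases p)
    case (Cons j q)
    with that R'(2)[of j "q @ [i]"] show ?thesis
      by (auto simp: admissible_def)
  qed (use R in simp)
  ultimately show ?L using R by (auto simp: admissible_def)
qed

text \<open>\<open>Node (b # bs)\<close> is \<open>B_plus (fst b) (snd b) + Node bs\<close>, so
  trees are generated from \<open>0\<close> by \<open>B_plus\<close> and concatenation.\<close>

lemma roc_tree_induct [case_names zero B_plus plus]:
  assumes zero: "P 0"
    and B: "\<And>a t. P t \<Longrightarrow> P (B_plus a t)"
    and plus: "\<And>t s. P t \<Longrightarrow> P s \<Longrightarrow> P (t + s)"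
  shows "P t"
proof (induction t)
  case (Node bs)
  then show ?case
  proof (induction bs)
    case Nil
    then show ?case using zero by (simp add: zero_roc_tree_def)
  next
    case (Cons b bs)
    have "P (snd b)" using Cons.prems[of b "snd b"] by (cases b) auto
    then have "P (B_plus (fst b) (snd b))" by (rule B)
    moreover have "P (Node bs)" by (rule Cons.IH) (use Cons.prems in auto)
    ultimately have "P (B_plus (fst b) (snd b) + Node bs)" by (rule plus)
    then show ?case by (simp add: B_plus_def)
  qed
qed

lemma finite_vertices: "finite (vertices t)"
  by (induction t rule: vertices.induct) simp

lemma finite_admissible [simp]: "finite (admissible t)"
  by (rule finite_subset[of _ "Pow (vertices t)"]) (auto simp: admissible_def finite_vertices)

lemma admissible_zero: "admissible 0 = {{[]}}"
proof -
  have "S \<in> admissible 0 \<longleftrightarrow> S = {[]}" for S :: "nat list set"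
  proof -
    have "(\<forall>i p. i # p \<notin> S) \<longleftrightarrow> S \<subseteq> {[]}"
      by (metis insert_iff list.exhaust list.simps(3) subset_iff empty_iff)
    then show ?thesis
      unfolding zero_roc_tree_def admissible_Node by auto
  qed
  then show ?thesis by blast
qed

section \<open>Cuts of a planted tree\<close>

definition plant :: "nat list set \<Rightarrow> nat list set" where
  "plant S = insert [] ((#) 0 ` S)"

lemma inj_plant: "inj plant"
proof
  fix S T :: "nat list set"
  assume "plant S = plant T"
  then have "{p. 0 # p \<in> plant S} = {p. 0 # p \<in> plant T}" by simp
  then show "S = T" by (auto simp: plant_def)
qed

lemma admissible_B_plus: "admissible (B_plus a t) = insert {[]} (plant ` admissible t)"
proof (intro equalityI subsetI)
  fix S assume "S \<in> admissible (B_plus a t)"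
  then have S: "[] \<in> S" "\<And>i. {p. i # p \<in> S} = {} \<or> i = 0 \<and> {p. i # p \<in> S} \<in> admissible t"
    by (auto simp: B_plus_def admissible_Node)
  have eq: "S = plant {p. 0 # p \<in> S}"
  proof (intro set_eqI)
    fix p show "p \<in> S \<longleftrightarrow> p \<in> plant {p. 0 # p \<in> S}"
      using S(1) S(2)[of "hd p"] by (cases p) (auto simp: plant_def)
  qed
  show "S \<in> insert {[]} (plant ` admissible t)"
  proof (cases "{p. 0 # p \<in> S} = {}")
    case True
    then show ?thesis using eq by (simp add: plant_def)
  next
    case False
    then show ?thesis using eq S(2)[of 0] by blast
  qed
next
  fix S assume "S \<in> insert {[]} (plant ` admissible t)"
  then show "S \<in> admissible (B_plus a t)"
    by (auto simp: B_plus_def admissible_Node plant_def image_iff)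
qed

text \<open>A planted admissible set contains \<open>[0]\<close>. Hence the union in
  \<open>admissible_B_plus\<close> is disjoint and sums over it split.\<close>

lemma root_notin_plant_admissible: "{[]} \<notin> plant ` admissible t"
  by (auto simp: plant_def admissible_def)

lemma complementary_tree_root_B_plus: "complementary_tree {[]} (B_plus a t) = B_plus a t"
  by (simp add: complementary_tree_def B_plus_def)

lemma subtree_root_B_plus: "subtree {[]} (B_plus a t) = 0"
  by (simp add: B_plus_def zero_roc_tree_def)

lemma complementary_tree_plant:
  "S \<in> admissible t \<Longrightarrow> complementary_tree (plant S) (B_plus a t) = complementary_tree S t"
  by (simp add: complementary_tree_def B_plus_def plant_def image_iff admissible_def)

lemma subtree_plant:
  "S \<in> admissible t \<Longrightarrow> subtree (plant S) (B_plus a t) = B_plus a (subtree S t)"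
  by (simp add: B_plus_def plant_def image_iff admissible_def)

section \<open>Cuts of a concatenation\<close>

fun degree :: "'a roc_tree \<Rightarrow> nat" where
  "degree (Node bs) = length bs"

text \<open>With \<open>n\<close> the degree of \<open>t\<close>, an address in \<open>t + s\<close>
  whose first position is below \<open>n\<close> points into \<open>t\<close>; any other nonempty
  address is shifted down by \<open>n\<close> and points into \<open>s\<close>. The common root is
  always included.\<close>

definition juxtapose :: "nat \<Rightarrow> nat list set \<Rightarrow> nat list set \<Rightarrow> nat list set" where
  "juxtapose n S T = {p. case p of [] \<Rightarrow> True | i # q \<Rightarrow> if i < n then p \<in> S else (i - n) # q \<in> T}"

lemma mem_juxtapose [simp]:
  "[] \<in> juxtapose n S T"
  "i # p \<in> juxtapose n S T \<longleftrightarrow> (if i < n then i # p \<in> S else (i - n) # p \<in> T)"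
  by (auto simp: juxtapose_def)

text \<open>The inverse map restricts a cut to the two sides of the identified roots:
  \<open>left\<close> keeps the positions below \<open>n\<close>, \<open>right\<close> keeps the
  others and renumbers them from \<open>0\<close>.\<close>

lemma bij_betw_juxtapose:
  "bij_betw (\<lambda>(S, T). juxtapose (degree t) S T) (admissible t \<times> admissible s) (admissible (t + s))"
proof -
  obtain bs cs where t: "t = Node bs" and s: "s = Node cs" by (metis roc_tree.exhaust)
  define n where "n = length bs"
  define left where "left = (\<lambda>U::nat list set. {p. case p of [] \<Rightarrow> True | i # q \<Rightarrow> i < n \<and> p \<in> U})"
  define right where "right = (\<lambda>U::nat list set. {p. case p of [] \<Rightarrow> True | i # q \<Rightarrow> (i + n) # q \<in> U})"
  have left: "[] \<in> left U" "i # p \<in> left U \<longleftrightarrow> i < n \<and> i # p \<in> U"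
    and right: "[] \<in> right U" "i # p \<in> right U \<longleftrightarrow> (i + n) # p \<in> U" for i p U
    by (auto simp: left_def right_def)
  have adm: "juxtapose n S T \<in> admissible (Node (bs @ cs))"
    if "S \<in> admissible (Node bs)" "T \<in> admissible (Node cs)" for S T
    using that unfolding admissible_Node
    by (auto simp: n_def nth_append not_less dest: less_imp_le_nat)
  have adm_l: "left U \<in> admissible (Node bs)" if "U \<in> admissible (Node (bs @ cs))" for U
    using that unfolding admissible_Node
    by (auto simp: left n_def nth_append split: if_splits)
  have adm_r: "right U \<in> admissible (Node cs)" if "U \<in> admissible (Node (bs @ cs))" for U
    unfolding admissible_Node
  proof (intro conjI allI)
    fix i
    show "{p. i # p \<in> right U} = {} \<or> i < length cs \<and> {p. i # p \<in> right U} \<in> admissible (snd (cs ! i))"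
      using that[unfolded admissible_Node, THEN conjunct2, rule_format, of "i + n"]
      by (auto simp: right n_def nth_append)
  qed (rule right)
  have lj: "left (juxtapose n S T) = S" if "S \<in> admissible (Node bs)" for S T
  proof (rule set_eqI)
    fix p show "p \<in> left (juxtapose n S T) \<longleftrightarrow> p \<in> S"
      using that unfolding admissible_Node by (cases p) (auto simp: left n_def)
  qed
  have rj: "right (juxtapose n S T) = T" if "T \<in> admissible (Node cs)" for S T
  proof (rule set_eqI)
    fix p show "p \<in> right (juxtapose n S T) \<longleftrightarrow> p \<in> T"
      using that unfolding admissible_Node by (cases p) (auto simp: right)
  qed
  have j: "juxtapose n (left U) (right U) = U" if "U \<in> admissible (Node (bs @ cs))" for U
  proof (rule set_eqI)
    fix p show "p \<in> juxtapose n (left U) (right U) \<longleftrightarrow> p \<in> U"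
      using that unfolding admissible_Node by (cases p) (auto simp: left right)
  qed
  show ?thesis
    unfolding t s
    by (rule bij_betw_byWitness[where f' = "\<lambda>U. (left U, right U)"])
      (use adm adm_l adm_r lj rj j in \<open>auto simp: n_def\<close>)
qed

lemma upt_split: "[0..<m + n] = [0..<m] @ map (\<lambda>i. i + m) [0..<n]"
  by (simp add: map_add_upt add.commute upt_add_eq_append[of 0, simplified])

lemma complementary_tree_juxtapose:
  "complementary_tree (juxtapose (degree t) S T) (t + s) =
    complementary_tree S t + complementary_tree T s"
proof -
  obtain bs cs where t: "t = Node bs" and s: "s = Node cs" by (metis roc_tree.exhaust)
  have "pruned (juxtapose (length bs) S T) (Node (bs @ cs)) = pruned S (Node bs) @ pruned T (Node cs)"
    by (simp add: upt_split nth_append o_def cong: if_cong) 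
       (intro arg_cong[where f = concat] map_cong; simp)
  then show ?thesis by (simp add: complementary_tree_def t s)
qed

lemma subtree_juxtapose:
  "subtree (juxtapose (degree t) S T) (t + s) = subtree S t + subtree T s"
proof -
  obtain bs cs where t: "t = Node bs" and s: "s = Node cs" by (metis roc_tree.exhaust)
  have "filter (\<lambda>i. [i] \<in> juxtapose (length bs) S T) [0..<length bs] =
      filter (\<lambda>i. [i] \<in> S) [0..<length bs]"
    by (rule filter_cong) auto
  then show ?thesis
    by (simp add: t s upt_split nth_append o_def filter_map)
qed

lemma complementary_tree_zero: "complementary_tree S 0 = 0"
  by (simp add: complementary_tree_def zero_roc_tree_def)

lemma subtree_zero: "subtree S 0 = 0"
  by (simp add: zero_roc_tree_def)

text \<open>Eliminates addresses: the triples of a tree, its complementary tree and its subtree are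
  generated by four rules. In \<open>plant\<close> the complementary tree is unchanged, since the
  new lowest edge is kept.\<close>

lemma admissible_induct [consumes 1, case_names zero root plant plus]:
  assumes "S \<in> admissible t"
    and zero: "P 0 0 0"
    and root: "\<And>a t. P (B_plus a t) (B_plus a t) 0"
    and plant: "\<And>a t u v. P t u v \<Longrightarrow> P (B_plus a t) u (B_plus a v)"
    and plus: "\<And>t u v s u' v'. P t u v \<Longrightarrow> P s u' v' \<Longrightarrow> P (t + s) (u + u') (v + v')"
  shows "P t (complementary_tree S t) (subtree S t)"
  using assms(1)
proof (induction t arbitrary: S rule: roc_tree_induct)
  case zero
  then show ?case using \<open>P 0 0 0\<close> by (simp add: complementary_tree_zero subtree_zero)
next
  case (B_plus a t)
  then show ?case
    using root[of a t] plant
    by (auto simp: admissible_B_plus complementary_tree_root_B_plus subtree_root_B_plus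
        complementary_tree_plant subtree_plant)
next
  case (plus t s)
  from plus.prems have "S \<in> (\<lambda>(S1, S2). juxtapose (degree t) S1 S2) ` (admissible t \<times> admissible s)"
    by (simp add: bij_betw_imp_surj_on[OF bij_betw_juxtapose])
  then obtain S1 S2 where "S1 \<in> admissible t" "S2 \<in> admissible s"
    and "S = juxtapose (degree t) S1 S2"
    by auto
  then show ?case
    using plus.IH assms(5) by (simp add: complementary_tree_juxtapose subtree_juxtapose)
qed

section \<open>Sums over admissible subtrees\<close>

text \<open>The value on \<Delta>(t) of the bilinear map given by \<open>h\<close> on pairs of
  trees, that is, a sum in Sweedler notation. Identities for \<Delta> are stated against an
  arbitrary \<open>h\<close>, so iterated coproducts become nested sums without triple
  tensors.\<close>

definition cut_sum ::
    "('a roc_tree \<Rightarrow> 'a roc_tree \<Rightarrow> 'v::comm_monoid_add) \<Rightarrow> 'a roc_tree \<Rightarrow> 'v" where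
  "cut_sum h t = (\<Sum>S\<in>admissible t. h (complementary_tree S t) (subtree S t))"

lemma cut_sum_cong:
  assumes "\<And>S. S \<in> admissible t \<Longrightarrow>
    f (complementary_tree S t) (subtree S t) = g (complementary_tree S t) (subtree S t)"
  shows "cut_sum f t = cut_sum g t"
  unfolding cut_sum_def by (rule sum.cong) (simp_all add: assms)

lemma cut_sum_zero: "cut_sum h 0 = h 0 0"
  by (simp add: cut_sum_def admissible_zero complementary_tree_zero subtree_zero)

lemma cut_sum_B_plus:
  "cut_sum h (B_plus a t) = h (B_plus a t) 0 + cut_sum (\<lambda>u v. h u (B_plus a v)) t"
  by (simp add: cut_sum_def admissible_B_plus root_notin_plant_admissible
      complementary_tree_root_B_plus subtree_root_B_plus
      sum.reindex[OF inj_on_subset[OF inj_plant subset_UNIV]]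
      complementary_tree_plant subtree_plant)

text \<open>Multiplicativity of \<Delta>, from the bijection between cuts of \<open>t + s\<close>
  and pairs of cuts.\<close>

lemma cut_sum_plus:
  "cut_sum h (t + s) = cut_sum (\<lambda>u v. cut_sum (\<lambda>u' v'. h (u + u') (v + v')) s) t"
  unfolding cut_sum_def sum.cartesian_product
  by (subst sum.reindex_bij_betw[OF bij_betw_juxtapose, symmetric])
    (simp add: case_prod_unfold complementary_tree_juxtapose subtree_juxtapose)

lemma cut_sum_swap:
  "cut_sum (\<lambda>u v. cut_sum (\<lambda>u' v'. h u v u' v') s) t =
    cut_sum (\<lambda>u' v'. cut_sum (\<lambda>u v. h u v u' v') t) s"
  unfolding cut_sum_def by (rule sum.swap)

lemma cut_sum_add: "cut_sum (\<lambda>u v. f u v + g u v) t = cut_sum f t + cut_sum g t"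
  unfolding cut_sum_def by (rule sum.distrib)

lemma cut_sum_const_0: "cut_sum (\<lambda>u v. 0) t = 0"
  by (simp add: cut_sum_def)

lemma cut_sum_uminus: "cut_sum (\<lambda>u v. - f u v) t = - cut_sum f t"
  for f :: "'a roc_tree \<Rightarrow> 'a roc_tree \<Rightarrow> 'v::ab_group_add"
  unfolding cut_sum_def by (rule sum_negf)

lemma cut_sum_mult_left: "cut_sum (\<lambda>u v. c * f u v) t = c * cut_sum f t"
  for c :: "'v::semiring_0"
  unfolding cut_sum_def by (simp add: sum_distrib_left)

lemma cut_sum_mult_right: "cut_sum (\<lambda>u v. f u v * c) t = cut_sum f t * c"
  for c :: "'v::semiring_0"
  unfolding cut_sum_def by (simp add: sum_distrib_right)

text \<open>Coassociativity of \<Delta>. In the planted case two boundary sums agree and the rest is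
  the hypothesis with \<open>B_plus a\<close> in the last slot of \<open>h\<close>. For
  \<open>t + s\<close> the sums are regrouped so that the two hypotheses apply in turn.\<close>

lemma cut_sum_coassoc:
  "cut_sum (\<lambda>u v. cut_sum (\<lambda>u1 u2. h u1 u2 v) u) t =
    cut_sum (\<lambda>u v. cut_sum (\<lambda>v1 v2. h u v1 v2) v) t"
proof (induction t arbitrary: h rule: roc_tree_induct)
  case zero
  then show ?case by (simp add: cut_sum_zero)
next
  case (B_plus a t)
  then show ?case
    by (simp add: cut_sum_B_plus cut_sum_zero cut_sum_add add.assoc)
next
  case (plus t s)
  have "cut_sum (\<lambda>u v. cut_sum (\<lambda>u1 u2. h u1 u2 v) u) (t + s) =
      cut_sum (\<lambda>u v. cut_sum (\<lambda>u1 u2. cut_sum (\<lambda>u' v'.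
        cut_sum (\<lambda>u1' u2'. h (u1 + u1') (u2 + u2') (v + v')) u') s) u) t"
    by (simp add: cut_sum_plus cut_sum_swap[where s = s])
  also have "\<dots> = cut_sum (\<lambda>u v. cut_sum (\<lambda>v1 v2. cut_sum (\<lambda>u' v'.
        cut_sum (\<lambda>u1' u2'. h (u + u1') (v1 + u2') (v2 + v')) u') s) v) t"
    by (rule plus.IH(1))
  also have "\<dots> = cut_sum (\<lambda>u v. cut_sum (\<lambda>v1 v2. cut_sum (\<lambda>u' v'.
        cut_sum (\<lambda>v1' v2'. h (u + u') (v1 + v1') (v2 + v2')) v') s) v) t"
    by (simp only: plus.IH(2))
  also have "\<dots> = cut_sum (\<lambda>u v. cut_sum (\<lambda>v1 v2. h u v1 v2) v) (t + s)"
    by (simp add: cut_sum_plus cut_sum_swap[where s = s])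
  finally show ?case .
qed

lemma plus_roc_tree_eq_0_iff: "t + s = 0 \<longleftrightarrow> t = 0 \<and> s = 0" for t s :: "'a roc_tree"
  by (cases t; cases s) (simp add: zero_roc_tree_def)

lemma B_plus_neq_0 [simp]: "B_plus a t \<noteq> 0"
  by (simp add: B_plus_def zero_roc_tree_def)

text \<open>The left counit law: the complementary tree is trivial only for the cut that prunes
  nothing, and its subtree is \<open>t\<close>.\<close>

lemma cut_sum_counit: "cut_sum (\<lambda>u v. if u = 0 then h v else 0) t = h t"
proof (induction t arbitrary: h rule: roc_tree_induct)
  case (plus t s)
  have "cut_sum (\<lambda>u v. if u = 0 then h v else 0) (t + s) =
      cut_sum (\<lambda>u v. if u = 0 then cut_sum (\<lambda>u' v'. if u' = 0 then h (v + v') else 0) s else 0) t"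
    unfolding cut_sum_plus plus_roc_tree_eq_0_iff
    by (intro arg_cong[where f = "\<lambda>h. cut_sum h t"] ext) (simp add: cut_sum_def)
  then show ?case by (simp add: plus.IH)
qed (simp_all add: cut_sum_zero cut_sum_B_plus)

section \<open>The antipode\<close>

text \<open>The shared root is counted in both summands, whence the \<open>Suc\<close>.\<close>

lemma size_plus_roc_tree: "Suc (size (t + s)) = size t + size s" for t s :: "'a roc_tree"
  by (cases t; cases s) simp

lemma size_B_plus: "size (B_plus a t) = size t + 3"
  by (simp add: B_plus_def)

text \<open>Makes the recursion of \<open>antipode_tree\<close> terminate, as it calls itself on
  complementary trees.\<close>

lemma size_complementary_tree_le:
  assumes "S \<in> admissible t"
  shows "size (complementary_tree S t) \<le> size t"
  using assms
proof (induction rule: admissible_induct)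
  case (plus t u v s u' v')
  then show ?case using size_plus_roc_tree[of t s] size_plus_roc_tree[of u u'] by simp
qed (simp_all add: size_B_plus)

abbreviation basis :: "'b \<Rightarrow> ('b \<Rightarrow>\<^sub>0 'k::field)" where
  "basis b \<equiv> Poly_Mapping.single b 1"

lemma basis_plus: "basis (t + s) = basis t * basis s"
  by (simp add: mult_single)

text \<open>The leftmost branch contributes the rightmost factor because an antipode reverses
  products. The negated sum solves the left inverse equation on \<open>B_plus a t\<close> for the
  term of the cut that keeps only the root.\<close>

function antipode_tree :: "'a roc_tree \<Rightarrow> ('a roc_tree \<Rightarrow>\<^sub>0 'k::field)" where
  "antipode_tree (Node []) = 1"
| "antipode_tree (Node ((a, t) # bs)) =
    antipode_tree (Node bs) *
    (- (\<Sum>S\<in>admissible t. antipode_tree (complementary_tree S t) * basis (B_plus a (subtree S t))))"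
  by pat_completeness auto
termination
  by (relation "measure size") (auto dest: size_complementary_tree_le)

declare antipode_tree.simps [simp del]

lemma antipode_tree_zero: "antipode_tree 0 = 1"
  by (simp add: zero_roc_tree_def antipode_tree.simps)

lemma antipode_tree_B_plus:
  "antipode_tree (B_plus a t) = - cut_sum (\<lambda>u v. antipode_tree u * basis (B_plus a v)) t"
  by (simp add: B_plus_def antipode_tree.simps cut_sum_def)

lemma antipode_tree_plus: "antipode_tree (t + s) = antipode_tree s * antipode_tree t"
proof (cases t)
  case (Node bs)
  have "antipode_tree (Node bs + s) = antipode_tree s * antipode_tree (Node bs)"
  proof (induction bs)
    case Nil
    then show ?case by (simp add: antipode_tree_zero flip: zero_roc_tree_def)
  next
    case (Cons b bs)
    then show ?case
      by (cases b; cases s) (simp add: antipode_tree.simps mult.assoc)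
  qed
  then show ?thesis using Node by simp
qed

text \<open>The planted case cancels by construction. Since \<open>antipode_tree\<close> reverses
  products, the sum over cuts of \<open>t\<close> stands between the factors coming from
  \<open>s\<close>, where the hypothesis for \<open>t\<close> collapses it.\<close>

lemma antipode_tree_left_inverse:
  "cut_sum (\<lambda>u v. antipode_tree u * basis v) t = (if t = 0 then 1 else 0)"
proof (induction t rule: roc_tree_induct)
  case zero
  then show ?case by (simp add: cut_sum_zero antipode_tree_zero)
next
  case (B_plus a t)
  then show ?case by (simp add: cut_sum_B_plus antipode_tree_B_plus)
next
  case (plus t s)
  have eq: "cut_sum (\<lambda>u v. antipode_tree u * basis v) (t + s) =
      cut_sum (\<lambda>u' v'. antipode_tree u' * cut_sum (\<lambda>u v. antipode_tree u * basis v) t * basis v') s"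
    unfolding cut_sum_plus
    by (subst cut_sum_swap)
      (simp add: antipode_tree_plus basis_plus mult.assoc flip: cut_sum_mult_left cut_sum_mult_right)
  show ?case
    unfolding eq plus.IH(1) using plus.IH(2)
    by (cases "t = 0") (simp_all add: cut_sum_const_0 plus_roc_tree_eq_0_iff)
qed

text \<open>Induction on size, because the claim is applied to complementary trees, which are not
  structural parts of \<open>t\<close>.\<close>

lemma antipode_tree_right_inverse:
  "cut_sum (\<lambda>u v. basis u * antipode_tree v) t = (if t = 0 then 1 else 0 :: 'a roc_tree \<Rightarrow>\<^sub>0 'k::field)"
proof (induction t rule: measure_induct_rule[where f = size])
  case (less t)
  show ?case
  proof (cases t rule: antipode_tree.cases)
    case 1
    then have "t = 0" by (simp add: zero_roc_tree_def)
    then show ?thesis by (simp add: cut_sum_zero antipode_tree_zero)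
  next
    case (2 a s bs)
    define r where "r = Node bs"
    have t: "t = B_plus a s + r" by (simp add: 2 r_def B_plus_def)
    have less_size: "size s < size t" "size r < size t" by (simp_all add: 2 r_def)
    then have small: "size (complementary_tree S s) < size t" if "S \<in> admissible s" for S
      using size_complementary_tree_le[OF that] by simp
    have "cut_sum (\<lambda>u v. basis u * antipode_tree (B_plus a v)) s =
        (- cut_sum (\<lambda>u v. cut_sum (\<lambda>v1 v2. basis u * antipode_tree v1 * basis (B_plus a v2)) v) s
          :: 'a roc_tree \<Rightarrow>\<^sub>0 'k)"
      by (simp add: antipode_tree_B_plus cut_sum_uminus mult.assoc cut_sum_mult_left)
    \<comment> \<open>Coassociativity moves the inner cuts from \<open>v\<close> to
      \<open>u\<close>, a complementary tree of \<open>s\<close>; it is smaller than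
      \<open>t\<close>, so the induction hypothesis evaluates the inner sum.\<close>
    also have "\<dots> = - cut_sum (\<lambda>u v. cut_sum (\<lambda>u1 u2. basis u1 * antipode_tree u2) u * basis (B_plus a v)) s"
      by (simp flip: cut_sum_coassoc cut_sum_mult_right)
    also have "\<dots> = - cut_sum (\<lambda>u v. if u = 0 then basis (B_plus a v) else 0) s"
      by (intro arg_cong[where f = uminus] cut_sum_cong) (simp add: less.IH small)
    also have "\<dots> = - basis (B_plus a s)"
      by (simp add: cut_sum_counit[where h = "\<lambda>v. basis (B_plus a v)"])
    finally have B: "cut_sum (\<lambda>u v. basis u * antipode_tree v) (B_plus a s) =
        (0 :: 'a roc_tree \<Rightarrow>\<^sub>0 'k)"
      by (simp add: cut_sum_B_plus antipode_tree_zero)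
    \<comment> \<open>The sum over cuts of \<open>r\<close> stands between the factors coming from
      \<open>B_plus a s\<close>. It equals \<open>1\<close> or \<open>0\<close>; when it is
      \<open>1\<close>, fact \<open>B\<close> gives the vanishing.\<close>
    have "cut_sum (\<lambda>u v. basis u * antipode_tree v) t =
      (cut_sum (\<lambda>u v. basis u * cut_sum (\<lambda>u' v'. basis u' * antipode_tree v') r * antipode_tree v)
        (B_plus a s) :: 'a roc_tree \<Rightarrow>\<^sub>0 'k)"
      unfolding t cut_sum_plus
      by (simp add: antipode_tree_plus basis_plus mult.assoc flip: cut_sum_mult_left cut_sum_mult_right)
    also have "\<dots> = 0"
      using less.IH[OF less_size(2)] B by (simp add: cut_sum_def)
    finally show ?thesis by (simp add: t plus_roc_tree_eq_0_iff)
  qed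
qed

section \<open>Linear extension\<close>

definition lin :: "('b \<Rightarrow> ('c \<Rightarrow>\<^sub>0 'k::field)) \<Rightarrow> ('b \<Rightarrow>\<^sub>0 'k) \<Rightarrow> ('c \<Rightarrow>\<^sub>0 'k)" where
  "lin h x = (\<Sum>b\<in>Poly_Mapping.keys x. smul (Poly_Mapping.lookup x b) (h b))"

lemma lin_superset:
  assumes "finite K" "Poly_Mapping.keys x \<subseteq> K"
  shows "lin h x = (\<Sum>b\<in>K. smul (Poly_Mapping.lookup x b) (h b))"
  unfolding lin_def
  by (rule sum.mono_neutral_left) (use assms in \<open>auto simp: in_keys_iff\<close>)

lemma lin_add: "lin h (x + y) = lin h x + lin h y"
proof -
  define K where "K = Poly_Mapping.keys x \<union> Poly_Mapping.keys y"
  have "finite K" "Poly_Mapping.keys x \<subseteq> K" "Poly_Mapping.keys y \<subseteq> K"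
    "Poly_Mapping.keys (x + y) \<subseteq> K"
    using keys_add[of x y] by (auto simp: K_def)
  then show ?thesis
    by (simp add: lin_superset[of K] lookup_add free.scale_left_distrib sum.distrib)
qed

lemma lin_smul: "lin h (smul c x) = smul c (lin h x)"
proof -
  have "Poly_Mapping.keys (smul c x) \<subseteq> Poly_Mapping.keys x"
    by (auto simp: in_keys_iff)
  then show ?thesis
    by (simp add: lin_superset[of "Poly_Mapping.keys x"] free.scale_sum_right)
qed

lemma lin_zero: "lin h 0 = 0"
  by (simp add: lin_def)

lemma lin_basis: "lin h (basis b) = h b"
  by (simp add: lin_def)

lemma lin_sum: "lin h (\<Sum>i\<in>I. f i) = (\<Sum>i\<in>I. lin h (f i))"
  by (induction I rule: infinite_finite_induct) (simp_all add: lin_zero lin_add)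

lemma lin_lin: "lin h (lin g x) = lin (\<lambda>b. lin h (g b)) x"
  by (simp add: lin_def[of g] lin_def[of "\<lambda>b. lin h (g b)"] lin_sum lin_smul)

lemma lin_basis_self: "lin basis x = x"
proof (rule poly_mapping_eqI)
  fix b
  show "Poly_Mapping.lookup (lin basis x) b = Poly_Mapping.lookup x b"
    by (simp add: lin_def lookup_sum lookup_single when_def if_distrib[of "(*) _"] in_keys_iff
        cong: if_cong)
qed

lemma lin_in_subspace:
  assumes "free.subspace V" "\<And>b. b \<in> Poly_Mapping.keys x \<Longrightarrow> h b \<in> V"
  shows "lin h x \<in> V"
  unfolding lin_def using assms by (intro free.subspace_sum free.subspace_scale)

lemma coproduct_eq_lin: "coproduct = lin coproduct_tree"
  by (simp add: fun_eq_iff coproduct_def lin_def)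

lemma coproduct_tree_eq_cut_sum: "coproduct_tree = cut_sum (\<lambda>u v. basis (u, v))"
  by (simp add: fun_eq_iff coproduct_tree_def cut_sum_def)

text \<open>Convolution evaluates \<open>f\<close> and \<open>g\<close> on basis vectors only, so it
  is linear in \<open>x\<close> and its identities can be checked on single trees as cut
  sums.\<close>

lemma convolution_eq_lin:
  "convolution f g x = lin (cut_sum (\<lambda>u v. f (basis u) * g (basis v))) x"
proof -
  have "convolution f g x = lin (\<lambda>(u, v). f (basis u) * g (basis v)) (coproduct x)"
    unfolding convolution_def lin_def by (intro sum.cong) auto
  also have "\<dots> = lin (cut_sum (\<lambda>u v. f (basis u) * g (basis v))) x"
    by (simp add: coproduct_eq_lin lin_lin coproduct_tree_eq_cut_sum cut_sum_def[abs_def] lin_sum lin_basis)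
  finally show ?thesis .
qed

lemma lin_counit: "lin (\<lambda>t. if t = 0 then 1 else 0) x = smul (counit x) 1"
  unfolding lin_def counit_def free.scale_sum_left by (intro sum.cong) auto

lemma convolution_antipode:
  "convolution (lin antipode_tree) id x = smul (counit x) 1"
  "convolution id (lin antipode_tree) x = smul (counit x) 1"
  by (simp_all add: convolution_eq_lin lin_basis ext[OF antipode_tree_left_inverse]
      ext[OF antipode_tree_right_inverse] flip: lin_counit)

section \<open>Subalgebras spanned by trees\<close>

text \<open>The span of the basis vectors in \<open>N\<close>; in particular
  \<open>tree_space A\<close> is \<open>supported (roc_trees A)\<close>.\<close>

definition supported :: "'b set \<Rightarrow> ('b \<Rightarrow>\<^sub>0 'k::field) set" where
  "supported N = {x. Poly_Mapping.keys x \<subseteq> N}"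

lemma basis_in_supported [simp]: "basis b \<in> supported N \<longleftrightarrow> b \<in> N"
  by (simp add: supported_def)

lemma subspace_supported: "free.subspace (supported N :: ('b \<Rightarrow>\<^sub>0 'k::field) set)"
proof (rule free.subspaceI)
  fix x y :: "'b \<Rightarrow>\<^sub>0 'k"
  assume "x \<in> supported N" "y \<in> supported N"
  then show "x + y \<in> supported N" using keys_add[of x y] by (auto simp: supported_def)
next
  fix x :: "'b \<Rightarrow>\<^sub>0 'k" and c
  assume "x \<in> supported N"
  then show "smul c x \<in> supported N" by (auto simp: supported_def in_keys_iff)
qed (simp add: supported_def)

text \<open>In the equivalence for \<open>+\<close>, closure under products gives a subalgebra, and
  closure under factors lets the antipode recursion descend to the branches.\<close>

definition cut_closed :: "'a roc_tree set \<Rightarrow> bool" where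
  "cut_closed N \<longleftrightarrow> 0 \<in> N \<and> (\<forall>t s. t + s \<in> N \<longleftrightarrow> t \<in> N \<and> s \<in> N) \<and>
    (\<forall>t\<in>N. \<forall>S\<in>admissible t. complementary_tree S t \<in> N \<and> subtree S t \<in> N)"

lemma cut_closedD:
  assumes "cut_closed N"
  shows "0 \<in> N" "t + s \<in> N \<longleftrightarrow> t \<in> N \<and> s \<in> N"
    "t \<in> N \<Longrightarrow> S \<in> admissible t \<Longrightarrow> complementary_tree S t \<in> N"
    "t \<in> N \<Longrightarrow> S \<in> admissible t \<Longrightarrow> subtree S t \<in> N"
  using assms by (auto simp: cut_closed_def)

lemma is_subalgebra_supported:
  assumes "cut_closed N"
  shows "is_subalgebra (supported N :: ('a roc_tree \<Rightarrow>\<^sub>0 'k::field) set)"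
  unfolding is_subalgebra_def
proof (intro conjI ballI)
  fix x y :: "'a roc_tree \<Rightarrow>\<^sub>0 'k"
  assume xy: "x \<in> supported N" "y \<in> supported N"
  show "x * y \<in> supported N"
    using keys_mult[of x y] xy cut_closedD(2)[OF assms] unfolding supported_def by blast
qed (use cut_closedD(1)[OF assms] in \<open>simp_all add: subspace_supported flip: single_one\<close>)

lemma basis_in_tensor_space:
  assumes "u \<in> N" "v \<in> N"
  shows "basis (u, v) \<in> tensor_space (supported N) (supported N)"
proof -
  have "basis (u, v) = tensor (basis u) (basis v)" by (simp add: tensor_def)
  moreover have "basis u \<in> supported N" "basis v \<in> supported N" using assms by simp_all
  ultimately show ?thesis
    unfolding tensor_space_def by (intro free.span_base CollectI exI conjI)
qed

lemma coproduct_supported: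
  assumes "cut_closed N" "x \<in> supported N"
  shows "coproduct x \<in> tensor_space (supported N) (supported N)"
  unfolding coproduct_eq_lin
proof (rule lin_in_subspace)
  show "free.subspace (tensor_space (supported N) (supported N))"
    by (simp add: tensor_space_def)
  fix t assume "t \<in> Poly_Mapping.keys x"
  then have "t \<in> N" using assms(2) by (auto simp: supported_def)
  show "coproduct_tree t \<in> tensor_space (supported N) (supported N)"
    unfolding coproduct_tree_def tensor_space_def
  proof (rule free.span_sum)
    fix S assume "S \<in> admissible t"
    then have "complementary_tree S t \<in> N" "subtree S t \<in> N"
      using cut_closedD(3,4)[OF assms(1) \<open>t \<in> N\<close>] by auto
    then show "basis (complementary_tree S t, subtree S t) \<in>
        free.span {tensor u v | u v. u \<in> supported N \<and> v \<in> supported N}"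
      by (rule basis_in_tensor_space[unfolded tensor_space_def])
  qed
qed

lemma antipode_tree_supported:
  assumes N: "cut_closed N" and "t \<in> N"
  shows "antipode_tree t \<in> (supported N :: ('a roc_tree \<Rightarrow>\<^sub>0 'k::field) set)"
  using assms(2)
proof (induction t rule: antipode_tree.induct)
  case 1
  then show ?case
    by (simp add: antipode_tree.simps is_subalgebra_supported[OF N, unfolded is_subalgebra_def])
next
  case (2 a t bs)
  note mult = is_subalgebra_supported[OF N, unfolded is_subalgebra_def, THEN conjunct2, THEN conjunct2,
      rule_format]
  have "B_plus a t + Node bs \<in> N" using 2 by (simp add: B_plus_def)
  then have Ba: "B_plus a t \<in> N" and "Node bs \<in> N" using cut_closedD(2)[OF N] by auto
  have "antipode_tree (complementary_tree S t) * basis (B_plus a (subtree S t)) \<in>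
      (supported N :: ('a roc_tree \<Rightarrow>\<^sub>0 'k) set)"
    if S: "S \<in> admissible t" for S
  proof (intro mult)
    \<comment> \<open>Cutting \<open>B_plus a t\<close> along \<open>plant S\<close> yields exactly
      the two trees of this summand, so closure of \<open>N\<close> covers both.\<close>
    have "plant S \<in> admissible (B_plus a t)" using S by (simp add: admissible_B_plus)
    with cut_closedD(3,4)[OF N Ba this] S
    have "complementary_tree S t \<in> N" "B_plus a (subtree S t) \<in> N"
      by (simp_all add: complementary_tree_plant subtree_plant)
    with S 2 show "antipode_tree (complementary_tree S t) \<in> (supported N :: ('a roc_tree \<Rightarrow>\<^sub>0 'k) set)"
      "basis (B_plus a (subtree S t)) \<in> (supported N :: ('a roc_tree \<Rightarrow>\<^sub>0 'k) set)" by auto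
  qed
  then have "- (\<Sum>S\<in>admissible t. antipode_tree (complementary_tree S t) * basis (B_plus a (subtree S t)))
      \<in> (supported N :: ('a roc_tree \<Rightarrow>\<^sub>0 'k) set)"
    by (intro free.subspace_neg free.subspace_sum subspace_supported)
  then show ?case
    unfolding antipode_tree.simps using 2 \<open>Node bs \<in> N\<close> by (intro mult) auto
qed

lemma antipode_supported:
  assumes "cut_closed N" "x \<in> supported N"
  shows "lin antipode_tree x \<in> supported N"
  using assms by (intro lin_in_subspace subspace_supported antipode_tree_supported)
    (auto simp: supported_def)

section \<open>Colours of cut trees and the Hopf subalgebra criterion\<close>

lemma colours_plus: "colours (t + s) = colours t \<union> colours s"
  by (cases t; cases s) auto

lemma colours_B_plus: "colours (B_plus a t) = insert a (colours t)"
  by (auto simp: B_plus_def)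

lemma colours_zero: "colours 0 = {}"
  by (simp add: zero_roc_tree_def)

lemma cut_closed_roc_trees: "cut_closed (roc_trees A)"
proof -
  have "colours (complementary_tree S t) \<subseteq> colours t \<and> colours (subtree S t) \<subseteq> colours t"
    if "S \<in> admissible t" for S and t :: "'a roc_tree"
    using that by (induction rule: admissible_induct)
      (auto simp: colours_plus colours_B_plus colours_zero)
  then show ?thesis
    by (fastforce simp: cut_closed_def roc_trees_def colours_plus colours_zero)
qed

text \<open>\<open>roc_trees A\<close> is itself cut-closed, so the one map
  \<open>lin antipode_tree\<close> is an antipode of the whole tree space and also preserves the
  span of \<open>N\<close>.\<close>

lemma is_Hopf_subalgebra_supported:
  assumes "cut_closed N" "N \<subseteq> roc_trees A"
  shows "is_Hopf_subalgebra A (supported N)"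
  unfolding is_Hopf_subalgebra_def
proof (intro conjI ballI exI)
  have tree_space: "tree_space A = supported (roc_trees A)"
    by (simp add: tree_space_def supported_def)
  show "supported N \<subseteq> tree_space A"
    using assms(2) by (auto simp: supported_def tree_space_def)
  show "is_antipode A (lin antipode_tree)"
    unfolding is_antipode_def tree_space
    by (auto simp: antipode_supported[OF cut_closed_roc_trees] lin_add lin_smul convolution_antipode)
qed (use assms in \<open>simp_all add: is_subalgebra_supported coproduct_supported antipode_supported\<close>)

section \<open>Tall trees\<close>

text \<open>The products of ladders, the empty product included, described branch by branch so that
  closure under products and factors is immediate.\<close>

definition tall_forests :: "'a set \<Rightarrow> 'a roc_tree set" where
  "tall_forests A = {Node bs | bs. \<forall>b\<in>set bs. Node [b] \<in> planted_tall_trees A}"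

lemma tall_forests_plus: "t + s \<in> tall_forests A \<longleftrightarrow> t \<in> tall_forests A \<and> s \<in> tall_forests A"
  by (cases t; cases s) (auto simp: tall_forests_def)

lemma tall_forests_zero: "0 \<in> tall_forests A"
  by (simp add: tall_forests_def zero_roc_tree_def)

lemma B_plus_eq_iff: "B_plus a t = B_plus b s \<longleftrightarrow> a = b \<and> t = s"
  by (simp add: B_plus_def)

lemma B_plus_in_planted_tall_trees_iff:
  "B_plus a t \<in> planted_tall_trees A \<longleftrightarrow> a \<in> A \<and> (t = 0 \<or> t \<in> planted_tall_trees A)"
proof
  assume "B_plus a t \<in> planted_tall_trees A"
  then obtain as where as: "B_plus a t = fold B_plus as 0" "as \<noteq> []" "set as \<subseteq> A"
    by (auto simp: planted_tall_trees_def)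
  \<comment> \<open>\<open>fold\<close> applies the last entry of \<open>as\<close> last, so the
    last colour sits on the lowest edge.\<close>
  then obtain bs where "t = fold B_plus bs 0" "as = bs @ [a]"
    by (cases as rule: rev_cases) (auto simp: B_plus_eq_iff)
  with as show "a \<in> A \<and> (t = 0 \<or> t \<in> planted_tall_trees A)"
    by (cases "bs = []") (auto simp: planted_tall_trees_def)
next
  assume "a \<in> A \<and> (t = 0 \<or> t \<in> planted_tall_trees A)"
  then have "a \<in> A" "\<exists>as. t = fold B_plus as 0 \<and> set as \<subseteq> A"
    by (auto simp: planted_tall_trees_def intro: exI[of _ "[]"])
  then obtain as where "a \<in> A" "t = fold B_plus as 0" "set as \<subseteq> A" by blast
  then have "B_plus a t = fold B_plus (as @ [a]) 0" "set (as @ [a]) \<subseteq> A" by auto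
  then show "B_plus a t \<in> planted_tall_trees A"
    unfolding planted_tall_trees_def by blast
qed

lemma planted_tall_tree_cases:
  assumes "t \<in> planted_tall_trees A"
  obtains a s where "t = B_plus a s"
proof -
  from assms obtain as where "t = fold B_plus as 0" "as \<noteq> []"
    by (auto simp: planted_tall_trees_def)
  then show ?thesis using that by (cases as rule: rev_cases) auto
qed

text \<open>Trades being a ladder, possibly trivial, for a bound on the degree, which is additive
  under \<open>+\<close> and can be tracked through cuts.\<close>

lemma tall_forests_degree_le_1_iff:
  "t \<in> tall_forests A \<and> degree t \<le> 1 \<longleftrightarrow> t = 0 \<or> t \<in> planted_tall_trees A"
proof
  assume "t \<in> tall_forests A \<and> degree t \<le> 1"
  then show "t = 0 \<or> t \<in> planted_tall_trees A"
    by (cases t) (auto simp: tall_forests_def zero_roc_tree_def le_Suc_eq length_Suc_conv)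
next
  assume "t = 0 \<or> t \<in> planted_tall_trees A"
  then show "t \<in> tall_forests A \<and> degree t \<le> 1"
  proof
    assume "t \<in> planted_tall_trees A"
    moreover from this obtain a s where "t = Node [(a, s)]"
      by (auto elim: planted_tall_tree_cases simp: B_plus_def)
    ultimately show ?thesis by (simp add: tall_forests_def)
  qed (simp add: tall_forests_zero zero_roc_tree_def tall_forests_def)
qed

lemma B_plus_in_tall_forests_iff:
  "B_plus a t \<in> tall_forests A \<longleftrightarrow> a \<in> A \<and> t \<in> tall_forests A \<and> degree t \<le> 1"
proof -
  have "B_plus a t \<in> tall_forests A \<longleftrightarrow> B_plus a t \<in> planted_tall_trees A"
    by (simp add: tall_forests_def B_plus_def)
  then show ?thesis
    by (simp only: B_plus_in_planted_tall_trees_iff tall_forests_degree_le_1_iff)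
qed

lemma degree_plus: "degree (t + s) = degree t + degree s"
  by (cases t; cases s) simp

lemma degree_zero: "degree 0 = 0"
  by (simp add: zero_roc_tree_def)

lemma degree_B_plus: "degree (B_plus a t) = 1"
  by (simp add: B_plus_def)

text \<open>The degree bound strengthens the induction: \<open>B_plus a v\<close> is tall only if
  \<open>v\<close> has at most one branch, which \<open>v\<close> inherits from the tree it was cut
  from.\<close>

lemma cut_closed_tall_forests: "cut_closed (tall_forests A)"
proof -
  have "(t \<in> tall_forests A \<longrightarrow>
      complementary_tree S t \<in> tall_forests A \<and> subtree S t \<in> tall_forests A) \<and>
      degree (subtree S t) \<le> degree t"
    if "S \<in> admissible t" for S and t :: "'a roc_tree"
    using that by (induction rule: admissible_induct)
      (auto simp: tall_forests_plus tall_forests_zero B_plus_in_tall_forests_iff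
        degree_plus degree_zero degree_B_plus)
  then show ?thesis
    by (auto simp: cut_closed_def tall_forests_plus tall_forests_zero)
qed

lemma tall_forests_subset_roc_trees: "tall_forests A \<subseteq> roc_trees A"
proof
  fix t assume "t \<in> tall_forests A"
  then show "t \<in> roc_trees A"
    by (induction t rule: roc_tree_induct)
      (auto simp: roc_trees_def tall_forests_plus B_plus_in_tall_forests_iff
        colours_plus colours_B_plus colours_zero)
qed

text \<open>A forest of ladders is the product of its ladders, and a vector supported on such
  forests is a linear combination of them, so every subalgebra containing the ladders contains
  it.\<close>

lemma subalgebra_generated_planted_tall_trees:
  "subalgebra_generated (basis ` planted_tall_trees A) = supported (tall_forests A)"
  unfolding subalgebra_generated_def
proof (rule hull_unique)
  show "basis ` planted_tall_trees A \<subseteq> supported (tall_forests A)"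
    using tall_forests_degree_le_1_iff by fastforce
  show "is_subalgebra (supported (tall_forests A))"
    by (rule is_subalgebra_supported[OF cut_closed_tall_forests])
  fix H :: "('a roc_tree \<Rightarrow>\<^sub>0 'k::field) set"
  assume gen: "basis ` planted_tall_trees A \<subseteq> H" and H: "is_subalgebra H"
  have basis: "basis t \<in> H" if "t \<in> tall_forests A" for t
    using that
  proof (induction t rule: roc_tree_induct)
    case zero
    then show ?case using H by (simp add: is_subalgebra_def)
  next
    case (B_plus a t)
    then have "B_plus a t \<in> planted_tall_trees A"
      by (simp add: tall_forests_def B_plus_def)
    then show ?case using gen by blast
  next
    case (plus t s)
    then show ?case using H by (simp add: tall_forests_plus basis_plus is_subalgebra_def)
  qed
  show "supported (tall_forests A) \<subseteq> H"
  proof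
    fix x :: "'a roc_tree \<Rightarrow>\<^sub>0 'k"
    assume "x \<in> supported (tall_forests A)"
    then have "lin basis x \<in> H"
      using H basis by (intro lin_in_subspace) (auto simp: supported_def is_subalgebra_def)
    then show "x \<in> H" by (simp add: lin_basis_self)
  qed
qed

theorem proposition3p3:
  fixes A :: "'a set"
  assumes "finite A"
  shows "is_Hopf_subalgebra A
    (subalgebra_generated
      ((\<lambda>t. Poly_Mapping.single t (1 :: 'k::field_char_0)) ` planted_tall_trees A))"
  unfolding subalgebra_generated_planted_tall_trees
  by (rule is_Hopf_subalgebra_supported[OF cut_closed_tall_forests tall_forests_subset_roc_trees])

end
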